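(* For every cell $K$, every edge $\sigma\in\mathcal{E}_K$, every positive discrete density $u$ and every discrete potential $\phi$, the edgewise entropy production $\mathcal{P}_{K,\sigma}[u,\phi]=\mathcal{F}_{K,\sigma}[u,\phi]\,(\mathrm{D}_{K,\sigma}\log u+\mathrm{D}_{K,\sigma}\phi)$ can be written as $$\mathcal{P}_{K,\sigma}[u,\phi]=\tau_\sigma^*\bigg(2B(|\mathrm{D}_{K,\sigma}\phi|)\,\mathrm{D}_{K,\sigma}\sqrt u+\frac{\widehat u_\sigma}{\overline u_\sigma^{1/2}}\,\mathrm{D}_{K,\sigma}\phi\bigg)^2,$$ where $\widehat u_\sigma=u_{K,\sigma}$ if $\mathrm{D}_{K,\sigma}\phi\ge0$ and $\widehat u_\sigma=u_K$ if $\mathrm{D}_{K,\sigma}\phi<0$, and $$\overline u_\sigma=\bigg(\frac{u_K^{1/2}+u_{K,\sigma}^{1/2}}{2}\bigg)^2,\qquad\tau_\sigma^*:=\tau_\sigma\frac{\overline u_\sigma}{\widetilde u_\sigma}\ge\frac{\tau_\sigma}{4},$$ with the edge density $\widetilde u_\sigma$ defined in the context.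
   Context: $\mathcal{T}$ is a finite-volume mesh with cells $K$; $\mathcal{E}_K$ is the set of edges (faces) of $K$. For a cellwise quantity $v=(v_K)_{K\in\mathcal{T}}$, together with given values $v_\sigma$ on exterior edges, $\mathrm{D}_{K,\sigma}v=v_{K,\sigma}-v_K$, where $v_{K,\sigma}=v_L$ if $\sigma=K|L$ and $v_{K,\sigma}=v_\sigma$ if $\sigma$ is exterior; $\mathrm{D}_{K,\sigma}f(v)=f(v_{K,\sigma})-f(v_K)$. A positive density has $u_K>0$ and $u_{K,\sigma}>0$. $\tau_\sigma=\mathrm{m}(\sigma)/\mathrm{d}_\sigma>0$ is the transmissibility coefficient ($\mathrm{m}(\sigma)$ the measure of $\sigma$; $\mathrm{d}_\sigma=d(x_K,x_L)$ if $\sigma=K|L$, $d(x_K,\sigma)$ if $\sigma$ is exterior, $x_K$ being the cell points). $B(s)=s/(e^s-1)$ for $s\neq0$, $B(0)=1$. The Scharfetter--Gummel flux is $\mathcal{F}_{K,\sigma}[u,\phi]=\tau_\sigma(B(-\mathrm{D}_{K,\sigma}\phi)u_{K,\sigma}-B(\mathrm{D}_{K,\sigma}\phi)u_K)$. With $x:=\mathrm{D}_{K,\sigma}\log u$, $y:=-\mathrm{D}_{K,\sigma}\phi$, set $$\widetilde u_\sigma=a_1u_{K,\sigma}+a_2u_K,\qquad a_1=\frac{B(y)-B(x)}{x-y},\quad a_2=\frac{B(-x)-B(-y)}{x-y}$$ (for $x=y$ understood as the limits $a_1=-B'(x)$, $a_2=-B'(-x)$); then $a_1,a_2>0$, $a_1+a_2=1$,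 and $\mathcal{F}_{K,\sigma}[u,\phi]=\tau_\sigma\widetilde u_\sigma(\mathrm{D}_{K,\sigma}\log u+\mathrm{D}_{K,\sigma}\phi)$. *)

theory Defs
  imports "HOL-Analysis.Analysis"
begin

section \<open>Finite-volume meshes\<close>

text \<open>The measure of a face in dimension one less than that of the ambient space. For a set \<open>S\<close>
  lying in a hyperplane with unit normal \<open>n\<close>, the prism of height 1 over \<open>S\<close> in the direction
  \<open>n\<close> has as its volume the measure of \<open>S\<close> inside the hyperplane. (In dimension one this is the
  counting measure of a point, namely 1.) The definition is meant for such flat sets only.\<close>

definition face_measure :: "'a::euclidean_space set \<Rightarrow> real" where
  "face_measure S =
     (let n = (SOME n. norm n = 1 \<and> (\<exists>c. S \<subseteq> {x. n \<bullet> x = c}))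
      in measure lebesgue ((\<lambda>(x, t). x + t *\<^sub>R n) ` (S \<times> {0..1})))"

record 'a mesh =
  region :: "'a set"
  cells :: "'a set set"
  edges :: "'a set \<Rightarrow> 'a set set"
  cell_point :: "'a set \<Rightarrow> 'a"

definition exterior :: "'a::euclidean_space mesh \<Rightarrow> 'a set \<Rightarrow> bool" where
  "exterior M \<sigma> \<longleftrightarrow> \<sigma> \<subseteq> frontier (region M)"

definition cells_at :: "'a mesh \<Rightarrow> 'a set \<Rightarrow> 'a set set" where
  "cells_at M \<sigma> = {K \<in> cells M. \<sigma> \<in> edges M K}"

text \<open>Neither convexity of the cells nor orthogonality of the segments between cell points to
  the edges is required. The conditions \<open>edge_flat\<close> and \<open>boundary\<close> make the cells polytopal.
  Two edges may share only a set of measure zero, so they may be taken closed or relatively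
  open.\<close>

locale fv_mesh =
  fixes M :: "'a::euclidean_space mesh"
  assumes region: "open (region M)" "bounded (region M)" "region M \<noteq> {}"
    and finite_cells: "finite (cells M)"
    and cell: "K \<in> cells M \<Longrightarrow> open K \<and> K \<noteq> {} \<and> K \<subseteq> region M"
    and cells_disjoint: "\<lbrakk>K \<in> cells M; L \<in> cells M; K \<noteq> L\<rbrakk> \<Longrightarrow> K \<inter> L = {}"
    and cells_cover: "(\<Union>K\<in>cells M. closure K) = closure (region M)"
    and finite_edges: "K \<in> cells M \<Longrightarrow> finite (edges M K)"
    and boundary: "K \<in> cells M \<Longrightarrow> frontier K = (\<Union>\<sigma>\<in>edges M K. closure \<sigma>)"
    and edge_flat: "\<lbrakk>K \<in> cells M; \<sigma> \<in> edges M K\<rbrakk> \<Longrightarrow> \<exists>n c. n \<noteq> 0 \<and> \<sigma> \<subseteq> {x. n \<bullet> x = c}"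
    and edge_measure: "\<lbrakk>K \<in> cells M; \<sigma> \<in> edges M K\<rbrakk> \<Longrightarrow> face_measure \<sigma> > 0"
    and edge_overlap: "\<lbrakk>K \<in> cells M; \<sigma> \<in> edges M K; L \<in> cells M; \<sigma>' \<in> edges M L; \<sigma> \<noteq> \<sigma>'\<rbrakk>
      \<Longrightarrow> face_measure (\<sigma> \<inter> \<sigma>') = 0"
    and edge_cells: "\<lbrakk>K \<in> cells M; \<sigma> \<in> edges M K\<rbrakk>
      \<Longrightarrow> card (cells_at M \<sigma>) = (if exterior M \<sigma> then 1 else 2)"
    and point_in_cell: "K \<in> cells M \<Longrightarrow> cell_point M K \<in> closure K"
    and points_distinct: "\<lbrakk>K \<in> cells M; L \<in> cells M; K \<noteq> L; \<sigma> \<in> edges M K; \<sigma> \<in> edges M L\<rbrakk>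
      \<Longrightarrow> cell_point M K \<noteq> cell_point M L"
    and point_off_boundary: "\<lbrakk>K \<in> cells M; \<sigma> \<in> edges M K; exterior M \<sigma>\<rbrakk>
      \<Longrightarrow> cell_point M K \<notin> closure \<sigma>"

text \<open>The cell \<open>L\<close> with \<open>\<sigma> = K|L\<close>; meaningful for interior edges \<open>\<sigma>\<close> of \<open>K\<close> only.\<close>

definition neighbour :: "'a mesh \<Rightarrow> 'a set \<Rightarrow> 'a set \<Rightarrow> 'a set" where
  "neighbour M K \<sigma> = (THE L. L \<in> cells_at M \<sigma> \<and> L \<noteq> K)"

definition edge_dist :: "'a::euclidean_space mesh \<Rightarrow> 'a set \<Rightarrow> 'a set \<Rightarrow> real" where
  "edge_dist M K \<sigma> =
     (if exterior M \<sigma> then infdist (cell_point M K) \<sigma>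
      else dist (cell_point M K) (cell_point M (neighbour M K \<sigma>)))"

definition transmissibility :: "'a::euclidean_space mesh \<Rightarrow> 'a set \<Rightarrow> 'a set \<Rightarrow> real" where
  "transmissibility M K \<sigma> = face_measure \<sigma> / edge_dist M K \<sigma>"

lemma (in fv_mesh) cells_at_interior:
  assumes "K \<in> cells M" "\<sigma> \<in> edges M K" "\<not> exterior M \<sigma>"
  shows "cells_at M \<sigma> = {K, neighbour M K \<sigma>}" "neighbour M K \<sigma> \<noteq> K"
proof -
  have K: "K \<in> cells_at M \<sigma>"
    using assms by (simp add: cells_at_def)
  have "card (cells_at M \<sigma>) = 2"
    using edge_cells assms by simp
  then obtain A B where AB: "cells_at M \<sigma> = {A, B}" "A \<noteq> B"
    by (meson card_2_iff)
  obtain L where L: "cells_at M \<sigma> = {K, L}" "L \<noteq> K"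
  proof (cases "K = A")
    case True
    with AB show thesis by (intro that[of B]) simp_all
  next
    case False
    with AB K have "K = B" by simp
    with AB show thesis by (intro that[of A]) (simp_all add: insert_commute)
  qed
  then have "neighbour M K \<sigma> = L"
    unfolding neighbour_def by (intro the_equality) auto
  with L show "cells_at M \<sigma> = {K, neighbour M K \<sigma>}" "neighbour M K \<sigma> \<noteq> K"
    by simp_all
qed

text \<open>The distance, hence also the transmissibility, depends on the edge only.\<close>

lemma (in fv_mesh) edge_dist_unique:
  assumes "K \<in> cells M" "\<sigma> \<in> edges M K" "L \<in> cells M" "\<sigma> \<in> edges M L"
  shows "edge_dist M K \<sigma> = edge_dist M L \<sigma>"
proof (cases "K = L")
  case False
  have KL: "K \<in> cells_at M \<sigma>" "L \<in> cells_at M \<sigma>"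
    using assms by (auto simp: cells_at_def)
  have int: "\<not> exterior M \<sigma>"
    using edge_cells[OF assms(1,2)] KL False by (metis card_1_singletonE singletonD)
  have "neighbour M K \<sigma> = L"
    using cells_at_interior(1)[OF assms(1,2) int] KL(2) False by blast
  moreover have "neighbour M L \<sigma> = K"
    using cells_at_interior(1)[OF assms(3,4) int] KL(1) False by blast
  ultimately show ?thesis
    using int by (simp add: edge_dist_def dist_commute)
qed simp

lemma (in fv_mesh) transmissibility_pos:
  assumes "K \<in> cells M" "\<sigma> \<in> edges M K"
  shows "transmissibility M K \<sigma> > 0"
proof -
  have m: "face_measure \<sigma> > 0"
    using edge_measure assms by blast
  have "edge_dist M K \<sigma> > 0"
  proof (cases "exterior M \<sigma>")
    case True
    have "\<sigma> \<noteq> {}"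
      using m by (auto simp: face_measure_def Let_def)
    moreover have "cell_point M K \<notin> closure \<sigma>"
      using point_off_boundary assms True by blast
    ultimately have "infdist (cell_point M K) \<sigma> \<noteq> 0"
      using in_closure_iff_infdist_zero by blast
    then show ?thesis
      using True infdist_nonneg[of "cell_point M K" \<sigma>] by (simp add: edge_dist_def)
  next
    case False
    have "neighbour M K \<sigma> \<in> cells_at M \<sigma>"
      using cells_at_interior[OF assms False] by auto
    then have "cell_point M K \<noteq> cell_point M (neighbour M K \<sigma>)"
      using cells_at_interior(2)[OF assms False] assms
      by (intro points_distinct[where \<sigma>=\<sigma>]) (auto simp: cells_at_def)
    then show ?thesis
      using False by (simp add: edge_dist_def)
  qed
  with m show ?thesis
    by (simp add: transmissibility_def)
qed

section \<open>Discrete functions\<close>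

text \<open>Values on the cells, together with values on the exterior edges.\<close>

record 'a discrete_fun =
  cell_val :: "'a set \<Rightarrow> real"
  ext_val :: "'a set \<Rightarrow> real"

definition outer_val :: "'a::euclidean_space mesh \<Rightarrow> 'a discrete_fun \<Rightarrow> 'a set \<Rightarrow> 'a set \<Rightarrow> real" where
  "outer_val M v K \<sigma> =
     (if exterior M \<sigma> then ext_val v \<sigma> else cell_val v (neighbour M K \<sigma>))"

definition edge_diff :: "'a::euclidean_space mesh \<Rightarrow> 'a discrete_fun \<Rightarrow> 'a set \<Rightarrow> 'a set \<Rightarrow> real" where
  "edge_diff M v K \<sigma> = outer_val M v K \<sigma> - cell_val v K"

definition edge_diff_of ::
    "'a::euclidean_space mesh \<Rightarrow> (real \<Rightarrow> real) \<Rightarrow> 'a discrete_fun \<Rightarrow> 'a set \<Rightarrow> 'a set \<Rightarrow> real" where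
  "edge_diff_of M f v K \<sigma> = f (outer_val M v K \<sigma>) - f (cell_val v K)"

definition positive_density :: "'a::euclidean_space mesh \<Rightarrow> 'a discrete_fun \<Rightarrow> bool" where
  "positive_density M u \<longleftrightarrow>
     (\<forall>K\<in>cells M. cell_val u K > 0 \<and> (\<forall>\<sigma>\<in>edges M K. outer_val M u K \<sigma> > 0))"

section \<open>The Scharfetter--Gummel scheme\<close>

definition Bern :: "real \<Rightarrow> real" where
  "Bern s = (if s = 0 then 1 else s / (exp s - 1))"

definition SG_flux ::
    "'a::euclidean_space mesh \<Rightarrow> 'a discrete_fun \<Rightarrow> 'a discrete_fun \<Rightarrow> 'a set \<Rightarrow> 'a set \<Rightarrow> real" where
  "SG_flux M u \<phi> K \<sigma> = transmissibility M K \<sigma> *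
     (Bern (- edge_diff M \<phi> K \<sigma>) * outer_val M u K \<sigma>
      - Bern (edge_diff M \<phi> K \<sigma>) * cell_val u K)"

text \<open>On the diagonal the weights take their limits as \<open>y\<close> tends to \<open>x\<close>.\<close>

definition SG_weight1 :: "real \<Rightarrow> real \<Rightarrow> real" where
  "SG_weight1 x y = (if x = y then - deriv Bern x else (Bern y - Bern x) / (x - y))"

definition SG_weight2 :: "real \<Rightarrow> real \<Rightarrow> real" where
  "SG_weight2 x y = (if x = y then - deriv Bern (- x) else (Bern (- x) - Bern (- y)) / (x - y))"

definition u_tilde ::
    "'a::euclidean_space mesh \<Rightarrow> 'a discrete_fun \<Rightarrow> 'a discrete_fun \<Rightarrow> 'a set \<Rightarrow> 'a set \<Rightarrow> real" where
  "u_tilde M u \<phi> K \<sigma> =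
     (let x = edge_diff_of M ln u K \<sigma>; y = - edge_diff M \<phi> K \<sigma>
      in SG_weight1 x y * outer_val M u K \<sigma> + SG_weight2 x y * cell_val u K)"

definition entropy_production ::
    "'a::euclidean_space mesh \<Rightarrow> 'a discrete_fun \<Rightarrow> 'a discrete_fun \<Rightarrow> 'a set \<Rightarrow> 'a set \<Rightarrow> real" where
  "entropy_production M u \<phi> K \<sigma> =
     SG_flux M u \<phi> K \<sigma> * (edge_diff_of M ln u K \<sigma> + edge_diff M \<phi> K \<sigma>)"

definition u_hat ::
    "'a::euclidean_space mesh \<Rightarrow> 'a discrete_fun \<Rightarrow> 'a discrete_fun \<Rightarrow> 'a set \<Rightarrow> 'a set \<Rightarrow> real" where
  "u_hat M u \<phi> K \<sigma> = (if edge_diff M \<phi> K \<sigma> \<ge> 0 then outer_val M u K \<sigma> else cell_val u K)"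

definition u_bar :: "'a::euclidean_space mesh \<Rightarrow> 'a discrete_fun \<Rightarrow> 'a set \<Rightarrow> 'a set \<Rightarrow> real" where
  "u_bar M u K \<sigma> = ((sqrt (cell_val u K) + sqrt (outer_val M u K \<sigma>)) / 2)\<^sup>2"

definition tau_star ::
    "'a::euclidean_space mesh \<Rightarrow> 'a discrete_fun \<Rightarrow> 'a discrete_fun \<Rightarrow> 'a set \<Rightarrow> 'a set \<Rightarrow> real" where
  "tau_star M u \<phi> K \<sigma> = transmissibility M K \<sigma> * (u_bar M u K \<sigma> / u_tilde M u \<phi> K \<sigma>)"

end

theory Submission
  imports Defs "HOL-Real_Asymp.Real_Asymp"
begin

text \<open>Write \<open>a\<close>, \<open>b\<close> for the inner and outer values of the density and \<open>d\<close> for the difference of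
  the potential. Both representations of the flux rest on identities for the Bernoulli function:
  \<open>B(-x) = e\<^sup>x B(x)\<close> makes the terms with \<open>x = ln (b/a)\<close> cancel, so that the edge density times
  \<open>x + d\<close> is \<open>G = B(-d) b - B(d) a\<close>, and \<open>B(-d) = B(d) + d\<close> shows that \<open>G\<close> is also the expression
  under the square times the root of the mean density. Since \<open>B' < 0\<close>, the edge density is a
  convex combination of \<open>a\<close> and \<open>b\<close>, hence at most \<open>(\<surd>a + \<surd>b)\<^sup>2\<close>.\<close>

lemma Bern_minus: "Bern (- s) = exp s * Bern s"
  by (auto simp: Bern_def exp_minus field_simps)

lemma Bern_minus_add: "Bern (- s) = Bern s + s"
  by (auto simp: Bern_def exp_minus field_simps)

text \<open>The case split at 0 is forced by the removable singularity: there the slope comes from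
  the difference quotient, elsewhere from the quotient rule.\<close>

lemma DERIV_Bern_neg: "\<exists>D < 0. (Bern has_real_derivative D) (at s)"
proof (cases "s = 0")
  case True
  \<comment> \<open>The value is the linear coefficient in
    \<open>h / (exp h - 1) = 1 - h / 2 + ...\<close>.\<close>
  have "((\<lambda>h::real. (h / (exp h - 1) - 1) / h) \<longlongrightarrow> - 1 / 2) (at 0)"
    by real_asymp
  moreover have "\<forall>\<^sub>F h in at 0. (h / (exp h - 1) - 1) / h = (Bern (0 + h) - Bern 0) / h"
    by (auto simp: Bern_def eventually_at_filter)
  ultimately have "(Bern has_real_derivative - 1 / 2) (at 0)"
    unfolding DERIV_def by (rule Lim_transform_eventually)
  then show ?thesis
    using True by (intro exI[of _ "- 1 / 2"]) simp
next
  case False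
  let ?D = "(exp s - 1 - s * exp s) / (exp s - 1)\<^sup>2"
  have "((\<lambda>s::real. s / (exp s - 1)) has_real_derivative ?D) (at s)"
    using False by (auto intro!: derivative_eq_intros simp: power2_eq_square)
  then have "(Bern has_real_derivative ?D) (at s)"
    by (rule has_field_derivative_transform_within_open[where S = "- {0}"])
       (use False in \<open>auto simp: Bern_def\<close>)
  moreover have "?D < 0"
  proof -
    \<comment> \<open>Multiplied by \<open>exp s\<close>, this strict tangent bound says that the
      numerator of \<open>?D\<close> is negative.\<close>
    have "1 - s < exp (- s)"
      using exp_minus_greater[of s] False by simp
    then have "(1 - s) * exp s < 1"
      by (simp add: exp_minus field_simps)
    then show ?thesis
      using False by (intro divide_neg_pos) (auto simp: algebra_simps)
  qed
  ultimately show ?thesis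
    by blast
qed

lemma DERIV_Bern: "(Bern has_real_derivative deriv Bern s) (at s)"
  using DERIV_Bern_neg[of s] DERIV_imp_deriv by blast

lemma deriv_Bern_neg: "deriv Bern s < 0"
  using DERIV_Bern_neg[of s] DERIV_imp_deriv by blast

text \<open>Differentiate both sides of \<open>Bern_minus_add\<close>. This is the diagonal case of
  \<open>SG_weight_sum\<close>.\<close>

lemma deriv_Bern_sum: "deriv Bern s + deriv Bern (- s) = - 1"
proof -
  have "((\<lambda>s. Bern (- s)) has_real_derivative - deriv Bern (- s)) (at s)"
    using DERIV_chain2[OF DERIV_Bern DERIV_minus[OF DERIV_ident]] by simp
  moreover have "((\<lambda>s. Bern (- s)) has_real_derivative deriv Bern s + 1) (at s)"
    unfolding Bern_minus_add by (intro DERIV_add DERIV_Bern DERIV_ident)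
  ultimately have "- deriv Bern (- s) = deriv Bern s + 1"
    by (rule DERIV_unique)
  then show ?thesis
    by simp
qed

lemma Bern_strict_antimono: "s < t \<Longrightarrow> Bern t < Bern s"
  by (rule DERIV_neg_imp_decreasing) (use DERIV_Bern_neg in auto)

lemma SG_weight1_pos: "SG_weight1 x y > 0"
  by (cases x y rule: linorder_cases)
     (auto simp: SG_weight1_def deriv_Bern_neg Bern_strict_antimono intro: divide_neg_neg)

lemma SG_weight2_pos: "SG_weight2 x y > 0"
  by (cases x y rule: linorder_cases)
     (auto simp: SG_weight2_def deriv_Bern_neg Bern_strict_antimono intro: divide_neg_neg)

text \<open>Off the diagonal, \<open>Bern_minus_add\<close> at \<open>x\<close> and at
  \<open>y\<close> turns the sum of the numerators into \<open>x - y\<close>.\<close>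

lemma SG_weight_sum: "SG_weight1 x y + SG_weight2 x y = 1"
proof (cases "x = y")
  case True
  then show ?thesis
    using deriv_Bern_sum[of x] by (simp add: SG_weight1_def SG_weight2_def)
next
  case False
  then show ?thesis
    by (simp add: SG_weight1_def SG_weight2_def add_divide_distrib[symmetric]
        Bern_minus_add[of x] Bern_minus_add[of y])
qed

lemma SG_weights_flux:
  assumes "a > 0" "b > 0"
  defines "x \<equiv> ln b - ln a"
  shows "(SG_weight1 x y * b + SG_weight2 x y * a) * (x - y) = Bern y * b - Bern (- y) * a"
proof -
  have b: "b = exp x * a"
    using assms by (simp add: exp_diff)
  show ?thesis
  proof (cases "x = y")
    \<comment> \<open>Both sides vanish: \<open>b = exp x * a\<close> balances the two terms on the
      right.\<close>
    case True
    then show ?thesis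
      by (simp add: b Bern_minus)
  next
    case False
    then have w: "SG_weight1 x y * (x - y) = Bern y - Bern x"
      "SG_weight2 x y * (x - y) = Bern (- x) - Bern (- y)"
      by (simp_all add: SG_weight1_def SG_weight2_def)
    have "(SG_weight1 x y * b + SG_weight2 x y * a) * (x - y)
        = (Bern y - Bern x) * b + (Bern (- x) - Bern (- y)) * a"
      unfolding w[symmetric] by (simp add: algebra_simps)
    also have "\<dots> = Bern y * b - Bern (- y) * a"
      by (simp add: b Bern_minus[of x] algebra_simps)
    finally show ?thesis .
  qed
qed

lemma SG_flux_sqrt_form:
  assumes "a > 0" "b > 0"
  defines "m \<equiv> (sqrt a + sqrt b) / 2"
  shows "m * (2 * Bern \<bar>d\<bar> * (sqrt b - sqrt a) + (if d \<ge> 0 then b else a) / m * d)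
    = Bern (- d) * b - Bern d * a"
proof -
  have "m > 0"
    using assms by (simp add: add_pos_pos)
  then have "m * (2 * Bern \<bar>d\<bar> * (sqrt b - sqrt a) + (if d \<ge> 0 then b else a) / m * d)
      = Bern \<bar>d\<bar> * (2 * m * (sqrt b - sqrt a)) + (if d \<ge> 0 then b else a) * d"
    by (simp add: field_simps)
  also have "2 * m * (sqrt b - sqrt a) = b - a"
    using square_diff_square_factored[of "sqrt b" "sqrt a"] assms by (simp add: m_def add.commute)
  \<comment> \<open>\<open>Bern \<bar>d\<bar>\<close> is the smaller of \<open>Bern d\<close> and
    \<open>Bern (- d)\<close>; the other exceeds it by \<open>\<bar>d\<bar>\<close>, and the density
    it multiplies is the upwind one.\<close>
  also have "Bern \<bar>d\<bar> * (b - a) + (if d \<ge> 0 then b else a) * d = Bern (- d) * b - Bern d * a"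
    using Bern_minus_add[of d] by (auto simp: algebra_simps)
  finally show ?thesis .
qed

lemma convex_combination_le_sum_sqrt_sq:
  assumes "a \<ge> 0" "b \<ge> 0" "v \<ge> 0" "w \<ge> 0" "v + w = 1"
  shows "v * b + w * a \<le> (sqrt a + sqrt b)\<^sup>2"
proof -
  have ab: "a \<le> (sqrt a + sqrt b)\<^sup>2" "b \<le> (sqrt a + sqrt b)\<^sup>2"
    using assms by (simp_all add: power2_sum)
  show ?thesis
    using convex_bound_le[OF ab(2,1) assms(3-5)] .
qed

theorem proposition6:
  fixes M :: "'a::euclidean_space mesh"
    and u \<phi> :: "'a discrete_fun"
    and K \<sigma> :: "'a set"
  assumes "fv_mesh M"
    and "K \<in> cells M"
    and "\<sigma> \<in> edges M K"
    and "positive_density M u"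
  shows "entropy_production M u \<phi> K \<sigma> =
           tau_star M u \<phi> K \<sigma> *
             (2 * Bern \<bar>edge_diff M \<phi> K \<sigma>\<bar> * edge_diff_of M sqrt u K \<sigma>
              + u_hat M u \<phi> K \<sigma> / sqrt (u_bar M u K \<sigma>) * edge_diff M \<phi> K \<sigma>)\<^sup>2
         \<and> tau_star M u \<phi> K \<sigma> \<ge> transmissibility M K \<sigma> / 4"
proof -
  define a b \<tau> d where "a = cell_val u K" and "b = outer_val M u K \<sigma>"
    and "\<tau> = transmissibility M K \<sigma>" and "d = edge_diff M \<phi> K \<sigma>"
  note defs = a_def[symmetric] b_def[symmetric] \<tau>_def[symmetric] d_def[symmetric]
  define x where "x = ln b - ln a"
  define m where "m = (sqrt a + sqrt b) / 2"
  define U where "U = SG_weight1 x (- d) * b + SG_weight2 x (- d) * a"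
  define G where "G = Bern (- d) * b - Bern d * a"
  define Q where "Q = 2 * Bern \<bar>d\<bar> * (sqrt b - sqrt a) + (if d \<ge> 0 then b else a) / m * d"
  have ab: "a > 0" "b > 0"
    using assms by (auto simp: positive_density_def a_def b_def)
  have \<tau>: "\<tau> > 0"
    using fv_mesh.transmissibility_pos assms(1-3) by (auto simp: \<tau>_def)
  have m: "m > 0"
    using ab by (simp add: m_def add_pos_pos)
  have U: "U > 0"
    using ab by (simp add: U_def SG_weight1_pos SG_weight2_pos add_pos_pos)
  have UG: "U * (x + d) = G"
    using SG_weights_flux[OF ab, of "- d"] by (simp add: U_def G_def x_def)
  have mG: "m * Q = G"
    using SG_flux_sqrt_form[OF ab, of d] by (simp add: Q_def G_def m_def)
  have "U \<le> (sqrt a + sqrt b)\<^sup>2"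
    unfolding U_def
    by (intro convex_combination_le_sum_sqrt_sq)
       (use ab in \<open>auto simp: SG_weight_sum less_imp_le SG_weight1_pos SG_weight2_pos\<close>)
  \<comment> \<open>The 4 is the squared denominator of \<open>m\<close>.\<close>
  then have "1 / 4 \<le> m\<^sup>2 / U"
    using U by (simp add: m_def field_simps power2_eq_square)
  then have ge: "\<tau> / 4 \<le> \<tau> * (m\<^sup>2 / U)"
    using \<tau> mult_left_mono[of "1 / 4" "m\<^sup>2 / U" \<tau>] by simp
  \<comment> \<open>By \<open>UG\<close>, the factor \<open>x + d\<close> is \<open>G / U\<close>;
    then \<open>mG\<close> turns the square of \<open>G\<close> into that of
    \<open>m * Q\<close>.\<close>
  have "\<tau> * G * (x + d) = \<tau> * (G\<^sup>2 / U)"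
    using U by (simp add: UG[symmetric] power2_eq_square)
  also have "\<dots> = \<tau> * (m\<^sup>2 / U) * Q\<^sup>2"
    by (simp add: mG[symmetric] power_mult_distrib)
  finally have "\<tau> * G * (x + d) = \<tau> * (m\<^sup>2 / U) * Q\<^sup>2" .
  moreover have "entropy_production M u \<phi> K \<sigma> = \<tau> * G * (x + d)"
    by (simp add: entropy_production_def SG_flux_def edge_diff_of_def defs G_def x_def)
  moreover have bar: "u_bar M u K \<sigma> = m\<^sup>2"
    by (simp add: u_bar_def defs m_def)
  moreover have star: "tau_star M u \<phi> K \<sigma> = \<tau> * (m\<^sup>2 / U)"
    by (simp add: tau_star_def u_tilde_def Let_def bar edge_diff_of_def defs U_def x_def)
  ultimately show ?thesis
    using ge m by (simp add: edge_diff_of_def u_hat_def defs Q_def)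
qed

end
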